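(* Let $\mathtt r\le \mathtt r_0$ and suppose that the following two conditions hold for this $\mathtt r$. (i) There is a constant $\omega(\mathtt r)\in[0,1/2]$ such that for all $\theta\in\Theta_0(\mathtt r)$ and all $|\lambda|\le \mathtt g$, $$\sup_{\gamma\in\mathbb R^p\setminus\{0\}}\log \mathbb E\exp\Big\{\lambda\,\frac{\gamma^\top\{\nabla\zeta(\theta)-\nabla\zeta(\theta^* )\}}{\omega(\mathtt r)\,\|V_0\gamma\|}\Big\}\le \frac{\nu_0^2\lambda^2}{2}.$$ (ii) There are a symmetric strictly positive-definite matrix $D_0^2$ and a constant $\delta(\mathtt r)\in[0,1/2]$ such that for all $\theta\in\Theta_0(\mathtt r)$, $\theta\neq\theta^*$, $$\Big|\frac{-2\,\mathbb E L(\theta,\theta^* )}{\|D_0(\theta-\theta^* )\|^2}-1\Big|\le\delta(\mathtt r).$$ Let $\varrho\ge 3\nu_0\,\omega(\mathtt r)$ and $\delta\ge\delta(\mathtt r)$ be such that $D_\epsilon^2=D_0^2(1-\delta)-\varrho V_0^2$ is positive definite, $\epsilon=(\delta,\varrho)$, $\underline\epsilon=-\epsilon$. Then on the random set $$C_\epsilon(\mathtt r)=\{\tilde\theta\in\Theta_0(\mathtt r),\ \|V_0D_{\underline\epsilon}^{-1}\xi_{\underline\epsilon}\|\le\mathtt r\}$$ it holds $$\|D_\epsilon(\tilde\theta-\theta^* )-\xi_\epsilon\|^2\le 2\Delta_\epsilon(\mathtt r).$$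
   Context: Setting. $\Theta\subseteq\mathbb R^p$. The data $Y$ have a distribution $\mathbb P$ with expectation $\mathbb E$. $L(\theta)=L(Y,\theta)$, $\theta\in\Theta$, is a random function (a quasi log-likelihood; $\mathbb P$ need not belong to any parametric family). Put $L(\theta,\theta')=L(\theta)-L(\theta')$. The quasi maximum likelihood estimator $\tilde\theta=\arg\max_{\theta\in\Theta}L(\theta)$ is assumed to exist (the maximum is attained; if not unique, $\tilde\theta$ is any maximizer). The target is $\theta^*=\arg\max_{\theta\in\Theta}\mathbb E L(\theta)$, and $\nabla\mathbb E L(\theta^* )=0$. The stochastic component $\zeta(\theta)=L(\theta)-\mathbb E L(\theta)$ is differentiable in $\theta$; thus $\nabla L(\theta^* )=\nabla\zeta(\theta^* )$. $V_0^2$ is a symmetric positive-definite $p\times p$ matrix (with symmetric root $V_0$), $\mathtt g>0$, $\nu_0\ge1$ and $\mathtt r_0>0$ are constants. The local set is $\Theta_0(\mathtt r)=\{\theta:\|V_0(\theta-\theta^* )\|\le \mathtt r\}$, a full ellipsoid contained in $\Theta$ for $\mathtt r\le\mathtt r_0$. When $\omega(\mathtt r)=0$, condition (i) means $\nabla\zeta(\theta)=\nabla\zeta(\theta^* )$ on $\Theta_0(\mathtt r)$. $D_{\underline\epsilon}^2=D_0^2(1+\delta)+\varrho V_0^2$; $\xi_\epsilon=D_\epsilon^{-1}\nabla L(\theta^* )$, $\xi_{\underline\epsilon}=D_{\underline\epsilon}^{-1}\nabla L(\theta^* )$ (symmetric positive-definite roots). With $\zeta(\theta,\theta^* )=\zeta(\theta)-\zeta(\theta^*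 )$, $$\Diamond_{\epsilon}(\mathtt r)=\sup_{\theta\in\Theta_0(\mathtt r)}\Big\{\zeta(\theta,\theta^* )-(\theta-\theta^* )^\top\nabla\zeta(\theta^* )-\tfrac{\varrho}{2}\|V_0(\theta-\theta^* )\|^2\Big\},$$ $$\Diamond_{\underline\epsilon}(\mathtt r)=\sup_{\theta\in\Theta_0(\mathtt r)}\Big\{-\zeta(\theta,\theta^* )+(\theta-\theta^* )^\top\nabla\zeta(\theta^* )-\tfrac{\varrho}{2}\|V_0(\theta-\theta^* )\|^2\Big\}.$$ The spread is $\Delta_\epsilon(\mathtt r)=\Diamond_\epsilon(\mathtt r)+\Diamond_{\underline\epsilon}(\mathtt r)+(\|\xi_\epsilon\|^2-\|\xi_{\underline\epsilon}\|^2)/2$. *)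

theory Defs
  imports "HOL-Probability.Probability"
begin

section \<open>Symmetric positive-definite matrices and their roots\<close>

definition pos_def_mat :: "real^'n^'n \<Rightarrow> bool" where
  "pos_def_mat A \<longleftrightarrow> transpose A = A \<and> (\<forall>x. x \<noteq> 0 \<longrightarrow> 0 < x \<bullet> (A *v x))"

text \<open>Meaningful only for symmetric positive-definite arguments, where the root exists and is
  unique.\<close>

definition mat_root :: "real^'n^'n \<Rightarrow> real^'n^'n" where
  "mat_root A = (THE B. pos_def_mat B \<and> B ** B = A)"

section \<open>Gradients and logarithms of possibly infinite moments\<close>

text \<open>The derivative is taken within \<open>S\<close>, so that it makes sense at points of the parameter set
  that are not interior. It is unique at every point of a full ellipsoid contained in \<open>S\<close>,
  including its boundary points.\<close>

definition grad_within :: "('a::real_inner) set \<Rightarrow> ('a \<Rightarrow> real) \<Rightarrow> 'a \<Rightarrow> 'a" where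
  "grad_within S f x = (SOME g. (f has_derivative (\<lambda>h. g \<bullet> h)) (at x within S))"

definition ext_ln :: "ennreal \<Rightarrow> ereal" where
  "ext_ln x = (if x = 0 then -\<infinity> else if x = \<infinity> then \<infinity> else ereal (ln (enn2real x)))"

section \<open>Quasi log-likelihood\<close>

text \<open>The measure \<open>M\<close> is the distribution of the data, and \<open>L y \<theta>\<close> is the quasi log-likelihood
  at \<open>\<theta>\<close> for the data value \<open>y\<close>.\<close>

definition EL :: "'y measure \<Rightarrow> ('y \<Rightarrow> 'a \<Rightarrow> real) \<Rightarrow> 'a \<Rightarrow> real" where
  "EL M L \<theta> = (\<integral>y. L y \<theta> \<partial>M)"

definition zeta :: "'y measure \<Rightarrow> ('y \<Rightarrow> 'a \<Rightarrow> real) \<Rightarrow> 'y \<Rightarrow> 'a \<Rightarrow> real" where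
  "zeta M L y \<theta> = L y \<theta> - EL M L \<theta>"

definition local_set :: "real^'p^'p \<Rightarrow> real^'p \<Rightarrow> real \<Rightarrow> (real^'p) set" where
  "local_set V0 \<theta>s r = {\<theta>. norm (V0 *v (\<theta> - \<theta>s)) \<le> r}"

text \<open>The exponential-moment condition on the gradient increments of \<open>zeta\<close>. For \<open>w = 0\<close> the
  quotient has no meaning and the condition reads as: at each point of the local set, the gradient
  almost surely equals the one at \<open>\<theta>s\<close>. An infinite exponential moment violates the condition.\<close>

definition exp_moment_cond ::
  "'y measure \<Rightarrow> ('y \<Rightarrow> real^'p \<Rightarrow> real) \<Rightarrow> (real^'p) set \<Rightarrow> real^'p^'p \<Rightarrow> real^'p
    \<Rightarrow> real \<Rightarrow> real \<Rightarrow> real \<Rightarrow> real \<Rightarrow> bool" where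
  "exp_moment_cond M L \<Theta> V0 \<theta>s g \<nu>0 r w \<longleftrightarrow>
    (if w = 0 then
       (\<forall>\<theta> \<in> local_set V0 \<theta>s r. AE y in M.
          grad_within \<Theta> (zeta M L y) \<theta> = grad_within \<Theta> (zeta M L y) \<theta>s)
     else
       (\<forall>\<theta> \<in> local_set V0 \<theta>s r. \<forall>l. \<bar>l\<bar> \<le> g \<longrightarrow>
          (SUP \<gamma> \<in> UNIV - {0}. ext_ln (\<integral>\<^sup>+ y. ennreal (exp (l *
              ((\<gamma> \<bullet> (grad_within \<Theta> (zeta M L y) \<theta> - grad_within \<Theta> (zeta M L y) \<theta>s))
                / (w * norm (V0 *v \<gamma>))))) \<partial>M))
          \<le> ereal (\<nu>0\<^sup>2 * l\<^sup>2 / 2)))"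

text \<open>For \<open>e = (\<delta>, \<rho>)\<close>, the lower matrix is obtained at \<open>- e = (- \<delta>, - \<rho>)\<close>.\<close>

definition D_sq :: "real^'p^'p \<Rightarrow> real^'p^'p \<Rightarrow> real \<times> real \<Rightarrow> real^'p^'p" where
  "D_sq D0_sq V0_sq e = (1 - fst e) *\<^sub>R D0_sq - snd e *\<^sub>R V0_sq"

definition xi ::
  "('y \<Rightarrow> real^'p \<Rightarrow> real) \<Rightarrow> (real^'p) set \<Rightarrow> real^'p \<Rightarrow> real^'p^'p \<Rightarrow> 'y \<Rightarrow> real^'p" where
  "xi L \<Theta> \<theta>s D y = matrix_inv D *v grad_within \<Theta> (L y) \<theta>s"

text \<open>When \<open>zeta\<close> is differentiable, the suprema below are over continuous functions on a compact
  set, so the real-valued \<open>SUP\<close> is the genuine supremum (the local set being nonempty for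
  \<open>r \<ge> 0\<close>).\<close>

definition diamond_upper ::
  "'y measure \<Rightarrow> ('y \<Rightarrow> real^'p \<Rightarrow> real) \<Rightarrow> (real^'p) set \<Rightarrow> real^'p^'p \<Rightarrow> real^'p
    \<Rightarrow> real \<Rightarrow> real \<Rightarrow> 'y \<Rightarrow> real" where
  "diamond_upper M L \<Theta> V0 \<theta>s \<rho> r y =
    (SUP \<theta> \<in> local_set V0 \<theta>s r.
       (zeta M L y \<theta> - zeta M L y \<theta>s) - (\<theta> - \<theta>s) \<bullet> grad_within \<Theta> (zeta M L y) \<theta>s
       - \<rho> / 2 * (norm (V0 *v (\<theta> - \<theta>s)))\<^sup>2)"

definition diamond_lower ::
  "'y measure \<Rightarrow> ('y \<Rightarrow> real^'p \<Rightarrow> real) \<Rightarrow> (real^'p) set \<Rightarrow> real^'p^'p \<Rightarrow> real^'p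
    \<Rightarrow> real \<Rightarrow> real \<Rightarrow> 'y \<Rightarrow> real" where
  "diamond_lower M L \<Theta> V0 \<theta>s \<rho> r y =
    (SUP \<theta> \<in> local_set V0 \<theta>s r.
       - (zeta M L y \<theta> - zeta M L y \<theta>s) + (\<theta> - \<theta>s) \<bullet> grad_within \<Theta> (zeta M L y) \<theta>s
       - \<rho> / 2 * (norm (V0 *v (\<theta> - \<theta>s)))\<^sup>2)"

definition spread ::
  "'y measure \<Rightarrow> ('y \<Rightarrow> real^'p \<Rightarrow> real) \<Rightarrow> (real^'p) set \<Rightarrow> real^'p^'p \<Rightarrow> real^'p^'p \<Rightarrow> real^'p
    \<Rightarrow> real \<times> real \<Rightarrow> real \<Rightarrow> 'y \<Rightarrow> real" where
  "spread M L \<Theta> V0_sq D0_sq \<theta>s e r y =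
    diamond_upper M L \<Theta> (mat_root V0_sq) \<theta>s (snd e) r y
    + diamond_lower M L \<Theta> (mat_root V0_sq) \<theta>s (snd e) r y
    + ((norm (xi L \<Theta> \<theta>s (mat_root (D_sq D0_sq V0_sq e)) y))\<^sup>2
       - (norm (xi L \<Theta> \<theta>s (mat_root (D_sq D0_sq V0_sq (- e))) y))\<^sup>2) / 2"

end

theory Submission
  imports Defs
begin

text \<open>
  Fix a data value and write \<open>h = \<theta> - \<theta>s\<close> and \<open>G\<close> for the score at \<open>\<theta>s\<close>. Inside the local set, the
  log-likelihood increment \<open>L(\<theta>) - L(\<theta>s)\<close> is the sum of its mean and its stochastic part. The mean
  is \<open>- \<bar>D0 h\<bar>\<^sup>2 / 2\<close> up to the relative error \<open>\<delta>\<close>; the stochastic part is \<open>h \<bullet> G\<close> up to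
  \<open>\<rho> \<bar>V0 h\<bar>\<^sup>2 / 2\<close> plus one of the two suprema whose sum enters the spread. Collecting the quadratic
  terms, the increment lies between two concave quadratic functions of \<open>h\<close>,
    \<open>h \<bullet> G - \<bar>D_low h\<bar>\<^sup>2 / 2 - S_low \<le> L(\<theta>) - L(\<theta>s) \<le> h \<bullet> G - \<bar>D_up h\<bar>\<^sup>2 / 2 + S_up\<close>,
  which are of the form \<open>\<bar>\<xi>\<bar>\<^sup>2 / 2 - \<bar>D h - \<xi>\<bar>\<^sup>2 / 2\<close> with \<open>\<xi> = D\<inverse> G\<close>, up to constants
  (\<open>pos_def_mat_complete_square\<close>).

  The upper bound is evaluated at the maximizer of \<open>L\<close>, the lower bound at its own vertex
  \<open>\<theta>s + D_low\<inverse> \<xi>_low\<close>, where the square vanishes. The second condition in the random set says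
  exactly that this vertex belongs to the local set. Since \<open>L\<close> at the maximizer is at least \<open>L\<close> at
  the vertex, the square \<open>\<bar>D_up h - \<xi>_up\<bar>\<^sup>2 / 2\<close> at the maximizer is at most
  \<open>S_up + S_low + (\<bar>\<xi>_up\<bar>\<^sup>2 - \<bar>\<xi>_low\<bar>\<^sup>2) / 2\<close>, the spread. The argument is pathwise.

  Two points need care. Everything above needs \<open>mat_root\<close> to be a genuine root, that is, existence
  and uniqueness of the positive-definite root, which come from diagonalizing self-adjoint maps
  (\<open>selfadjoint_orthonormal_eigenbasis\<close>). And the score of \<open>L\<close> must be the gradient of the
  stochastic part, which holds because the mean is stationary at \<open>\<theta>s\<close>, an interior point of the
  parameter set (\<open>grad_quasi_likelihood_at_target\<close>).
\<close>

section \<open>Diagonalization of self-adjoint maps\<close>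

text \<open>A maximizer of the quadratic form \<open>x \<bullet> f x\<close> on the unit sphere of \<open>S\<close> is an eigenvector: the
  homogeneous form \<open>c \<bar>x\<bar>\<^sup>2 - x \<bullet> f x\<close>, with \<open>c\<close> the maximum, is nonnegative on \<open>S\<close> and vanishes
  at the maximizer \<open>v\<close>, so its derivative there, twice \<open>c v - f v\<close>, has to vanish on \<open>S\<close>.\<close>

lemma selfadjoint_eigenvector:
  fixes f :: "'a::euclidean_space \<Rightarrow> 'a"
  assumes lin: "linear f" and sym: "\<And>x y. x \<bullet> f y = f x \<bullet> y"
    and S: "subspace S" "f ` S \<subseteq> S" "S \<noteq> {0}"
  obtains v c where "v \<in> S" "norm v = 1" "f v = c *\<^sub>R v"
proof -
  let ?K = "S \<inter> sphere 0 1"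
  obtain u where u: "u \<in> S" "u \<noteq> 0"
    using S subspace_0 by blast
  then have "(1 / norm u) *\<^sub>R u \<in> ?K"
    using S(1) by (simp add: subspace_scale)
  moreover have "compact ?K"
    by (simp add: S(1) closed_Int_compact closed_subspace)
  moreover have "continuous_on ?K (\<lambda>x. x \<bullet> f x)"
    by (intro continuous_intros linear_continuous_on linear_conv_bounded_linear[THEN iffD1] lin)
  ultimately obtain v where v: "v \<in> ?K" and max: "\<And>x. x \<in> ?K \<Longrightarrow> x \<bullet> f x \<le> v \<bullet> f v"
    using continuous_attains_sup[of ?K "\<lambda>x. x \<bullet> f x"] by blast
  define c where "c = v \<bullet> f v"
  define p where "p x = c * (x \<bullet> x) - x \<bullet> f x" for x
  have p_nonneg: "p x \<ge> 0" if "x \<in> S" for x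
  proof (cases "x = 0")
    case False
    then have "(1 / norm x) *\<^sub>R x \<in> ?K"
      using S(1) that by (simp add: subspace_scale)
    from max[OF this] False show ?thesis
      by (simp add: p_def c_def linear_scale[OF lin] field_simps power2_norm_eq_inner[symmetric]
          power2_eq_square)
  qed (simp add: p_def linear_0[OF lin])
  define w where "w = c *\<^sub>R v - f v"
  have vv: "v \<bullet> v = 1"
    using v by (simp add: norm_eq_1)
  have w: "w \<in> S"
    using v S unfolding w_def by (auto intro!: subspace_diff subspace_scale)
  have expand: "p (v + t *\<^sub>R w) = 2 * t * (w \<bullet> w) + t\<^sup>2 * p w" for t
  proof -
    have "v \<bullet> f w = f v \<bullet> w" using sym by simp
    then show ?thesis
      using vv by (simp add: p_def linear_add[OF lin] linear_scale[OF lin] inner_simps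
          power2_eq_square c_def[symmetric] inner_commute)
        (simp add: w_def inner_simps algebra_simps inner_commute c_def[symmetric])
  qed
  have "w = 0"
  proof (rule ccontr)
    assume "w \<noteq> 0"
    then have a: "w \<bullet> w > 0" by simp
    have b: "p w \<ge> 0" using w p_nonneg by simp
    \<comment> \<open>Against the slope \<open>w \<bullet> w\<close>, a step this short is not outweighed by the quadratic term; adding
      \<open>1\<close> keeps the denominator positive when \<open>p w = 0\<close>.\<close>
    define t where "t = - (w \<bullet> w) / (p w + 1)"
    have "v + t *\<^sub>R w \<in> S"
      using v w S(1) by (auto intro!: subspace_add subspace_scale)
    then have "0 \<le> t * (2 * (w \<bullet> w) + t * p w)"
      using p_nonneg[of "v + t *\<^sub>R w"] expand[of t]
      by (simp add: power2_eq_square algebra_simps)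
    moreover have "t < 0"
      using a b unfolding t_def by (simp add: field_simps)
    moreover have "t * p w \<ge> - (w \<bullet> w)"
      using a b unfolding t_def by (simp add: field_simps)
    then have "2 * (w \<bullet> w) + t * p w > 0" using a by linarith
    ultimately show False
      by (smt (verit) mult_neg_pos)
  qed
  then show ?thesis
    using that[of v c] v by (simp add: w_def)
qed

text \<open>Induction on the dimension: the orthogonal complement of an eigenvector within \<open>S\<close> is again
  invariant, by self-adjointness. Working with an invariant subspace rather than the whole space
  lets the induction stay inside one type.\<close>

lemma selfadjoint_orthonormal_eigenbasis:
  fixes f :: "'a::euclidean_space \<Rightarrow> 'a"
  assumes lin: "linear f" and sym: "\<And>x y. x \<bullet> f y = f x \<bullet> y"
    and "subspace S" "f ` S \<subseteq> S"
  shows "\<exists>E l. finite E \<and> E \<subseteq> S \<and> (\<forall>x\<in>E. \<forall>y\<in>E. x \<bullet> y = (if x = y then 1 else 0)) \<and>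
           (\<forall>b\<in>E. f b = l b *\<^sub>R b) \<and> (\<forall>x\<in>S. x = (\<Sum>b\<in>E. (b \<bullet> x) *\<^sub>R b))"
  using assms(3,4)
proof (induction "dim S" arbitrary: S rule: less_induct)
  case less
  note S = less.prems
  show ?case
  proof (cases "S = {0}")
    case True
    then show ?thesis
      by (intro exI[of _ "{}"]) auto
  next
    case False
    obtain v c where v: "v \<in> S" "norm v = 1" "f v = c *\<^sub>R v"
      using selfadjoint_eigenvector[OF lin sym S False] .
    have vv: "v \<bullet> v = 1"
      using v by (simp add: norm_eq_1)
    let ?T = "S \<inter> {x. v \<bullet> x = 0}"
    have T: "subspace ?T"
      using S(1) by (simp add: subspace_inter subspace_hyperplane)
    have "v \<bullet> f x = 0" if "v \<bullet> x = 0" for x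
      using that by (simp add: sym v(3))
    then have fT: "f ` ?T \<subseteq> ?T"
      using S(2) by auto
    have "?T \<subset> S"
      using v(1) vv by (metis (mono_tags, lifting) Int_iff Int_lower1 mem_Collect_eq psubsetI zero_neq_one)
    then have "dim ?T < dim S"
      using T S(1) by (intro dim_psubset) (metis span_eq_iff)
    from less.hyps[OF this T fT] obtain E l where E: "finite E" "E \<subseteq> ?T"
        "\<forall>x\<in>E. \<forall>y\<in>E. x \<bullet> y = (if x = y then 1 else 0)"
        "\<forall>b\<in>E. f b = l b *\<^sub>R b" "\<forall>x\<in>?T. x = (\<Sum>b\<in>E. (b \<bullet> x) *\<^sub>R b)"
      by blast
    have vE: "v \<notin> E" and vb: "\<And>b. b \<in> E \<Longrightarrow> v \<bullet> b = 0 \<and> b \<bullet> v = 0"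
      using E(2) vv by (auto simp: inner_commute)
    have "x = (\<Sum>b\<in>insert v E. (b \<bullet> x) *\<^sub>R b)" if "x \<in> S" for x
    proof -
      let ?y = "x - (v \<bullet> x) *\<^sub>R v"
      have "?y \<in> ?T"
        using that v S(1) by (auto simp: inner_simps vv intro: subspace_diff subspace_scale)
      then have "?y = (\<Sum>b\<in>E. (b \<bullet> ?y) *\<^sub>R b)"
        using E(5) by blast
      also have "\<dots> = (\<Sum>b\<in>E. (b \<bullet> x) *\<^sub>R b)"
        by (intro sum.cong) (auto simp: inner_simps vb)
      finally show ?thesis
        using E(1) vE by (simp add: algebra_simps)
    qed
    then show ?thesis
      using E v vE vb vv
      by (intro exI[of _ "insert v E"] exI[of _ "l(v := c)"]) auto
  qed
qed

lemma selfadjoint_eigenbasis_UNIV: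
  fixes f :: "'a::euclidean_space \<Rightarrow> 'a"
  assumes "linear f" "\<And>x y. x \<bullet> f y = f x \<bullet> y"
  obtains E l where "finite E"
    "\<And>x y. x \<in> E \<Longrightarrow> y \<in> E \<Longrightarrow> x \<bullet> y = (if x = y then 1 else 0)"
    "\<And>b. b \<in> E \<Longrightarrow> f b = l b *\<^sub>R b" "\<And>x. x = (\<Sum>b\<in>E. (b \<bullet> x) *\<^sub>R b)"
proof -
  from selfadjoint_orthonormal_eigenbasis[OF assms subspace_UNIV subset_UNIV]
  obtain E l where E: "finite E"
      "\<forall>x\<in>E. \<forall>y\<in>E. x \<bullet> y = (if x = y then 1 else 0)"
      "\<forall>b\<in>E. f b = l b *\<^sub>R b" "\<forall>x\<in>UNIV. x = (\<Sum>b\<in>E. (b \<bullet> x) *\<^sub>R b)"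
    by (elim exE conjE)
  show thesis
    by (rule that[of E l]) (fact E(1), rule E(2)[rule_format], assumption+,
        rule E(3)[rule_format], assumption, rule E(4)[rule_format], rule UNIV_I)
qed

section \<open>Positive-definite roots\<close>

lemma transpose_eq_iff_selfadjoint:
  fixes A :: "real^'n^'n"
  shows "transpose A = A \<longleftrightarrow> (\<forall>x y. x \<bullet> (A *v y) = (A *v x) \<bullet> y)"
proof -
  have "x \<bullet> (A *v y) = (transpose A *v x) \<bullet> y" for x y
    by (metis dot_lmul_matrix transpose_matrix_vector)
  then show ?thesis
    by (auto simp: matrix_eq) (metis vector_eq_rdot)+
qed

lemma pos_def_mat_selfadjoint: "pos_def_mat A \<Longrightarrow> x \<bullet> (A *v y) = (A *v x) \<bullet> y"
  by (simp add: pos_def_mat_def transpose_eq_iff_selfadjoint)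

text \<open>The root acts on an eigenvector basis by the square roots of the eigenvalues.\<close>

lemma pos_def_mat_root_exists:
  fixes A :: "real^'n^'n"
  assumes A: "pos_def_mat A"
  shows "\<exists>B. pos_def_mat B \<and> B ** B = A"
proof -
  obtain E l where E: "finite E"
      "\<And>x y. x \<in> E \<Longrightarrow> y \<in> E \<Longrightarrow> x \<bullet> y = (if x = y then 1 else 0)"
      "\<And>b. b \<in> E \<Longrightarrow> A *v b = l b *\<^sub>R b" "\<And>x. x = (\<Sum>b\<in>E. (b \<bullet> x) *\<^sub>R b)"
    by (rule selfadjoint_eigenbasis_UNIV
        [OF matrix_vector_mul_linear pos_def_mat_selfadjoint[OF A]]) (use that in blast)
  have l: "l b > 0" if "b \<in> E" for b
  proof -
    have "b \<bullet> b = 1" using E(2) that by simp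
    then have "b \<noteq> 0" by auto
    with A have "0 < b \<bullet> (A *v b)" by (simp add: pos_def_mat_def)
    then show ?thesis using E(3)[OF that] \<open>b \<bullet> b = 1\<close> by simp
  qed
  define h where "h x = (\<Sum>b\<in>E. (sqrt (l b) * (b \<bullet> x)) *\<^sub>R b)" for x
  define B where "B = matrix h"
  have "linear h"
    unfolding h_def
    by (intro linear_compose_sum ballI linearI) (auto simp: inner_simps algebra_simps)
  then have B: "B *v x = h x" for x
    by (simp add: B_def matrix_works)
  have ip: "b \<bullet> h x = sqrt (l b) * (b \<bullet> x)" if "b \<in> E" for b x
  proof -
    have "b \<bullet> h x = (\<Sum>b'\<in>E. if b = b' then sqrt (l b) * (b \<bullet> x) else 0)"
      unfolding h_def inner_sum_right by (intro sum.cong) (auto simp: E(2) that)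
    then show ?thesis using E(1) that by simp
  qed
  have "x \<bullet> h y = h x \<bullet> y" for x y
    unfolding h_def inner_sum_right inner_sum_left
    by (intro sum.cong) (auto simp: inner_commute)
  moreover have "0 < x \<bullet> h x" if "x \<noteq> 0" for x
  proof -
    have "\<exists>b\<in>E. b \<bullet> x \<noteq> 0"
      using E(4)[of x] that by (metis (no_types, lifting) scale_eq_0_iff sum.neutral)
    moreover have "x \<bullet> h x = (\<Sum>b\<in>E. sqrt (l b) * (b \<bullet> x)\<^sup>2)"
      unfolding h_def inner_sum_right
      by (intro sum.cong) (auto simp: inner_commute power2_eq_square)
    ultimately show ?thesis
      using l E(1) by (auto intro!: sum_pos2 simp: less_imp_le)
  qed
  ultimately have "pos_def_mat B"
    by (simp add: pos_def_mat_def transpose_eq_iff_selfadjoint B)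
  moreover have "h (h x) = A *v x" for x
  proof -
    have "A *v x = A *v (\<Sum>b\<in>E. (b \<bullet> x) *\<^sub>R b)"
      using E(4)[of x] by simp
    also have "\<dots> = (\<Sum>b\<in>E. (b \<bullet> x) *\<^sub>R (A *v b))"
      by (simp add: linear_sum[OF matrix_vector_mul_linear] matrix_vector_mult_scaleR)
    also have "\<dots> = (\<Sum>b\<in>E. (sqrt (l b) * (b \<bullet> h x)) *\<^sub>R b)"
      using l by (intro sum.cong) (auto simp: E(3) ip less_imp_le)
    finally show ?thesis
      by (simp add: h_def)
  qed
  then have "B ** B = A"
    by (simp add: matrix_eq B flip: matrix_vector_mul_assoc)
  ultimately show ?thesis by blast
qed

text \<open>Let \<open>b\<close> be an eigenvector of the symmetric matrix \<open>B - C\<close> with eigenvalue \<open>l\<close>. From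
  \<open>B\<^sup>2 - C\<^sup>2 = B (B - C) + (B - C) C\<close> it follows that
  \<open>0 = b \<bullet> (B\<^sup>2 - C\<^sup>2) b = l (b \<bullet> B b + b \<bullet> C b)\<close>, and the bracket is positive. So all eigenvalues of
  \<open>B - C\<close> are zero. This avoids comparing the eigenspaces of \<open>B\<close> and \<open>C\<close>.\<close>

lemma pos_def_mat_root_unique:
  fixes B C :: "real^'n^'n"
  assumes B: "pos_def_mat B" and C: "pos_def_mat C" and eq: "B ** B = C ** C"
  shows "B = C"
proof -
  let ?f = "\<lambda>x. (B - C) *v x"
  have f: "?f x = B *v x - C *v x" for x
    by (simp add: matrix_vector_mult_diff_rdistrib)
  have "linear ?f"
    by simp
  moreover have f_sym: "x \<bullet> ?f y = ?f x \<bullet> y" for x y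
    by (simp add: f inner_simps pos_def_mat_selfadjoint[OF B] pos_def_mat_selfadjoint[OF C])
  ultimately obtain E l where E: "finite E"
      "\<And>x y. x \<in> E \<Longrightarrow> y \<in> E \<Longrightarrow> x \<bullet> y = (if x = y then 1 else 0)"
      "\<And>b. b \<in> E \<Longrightarrow> ?f b = l b *\<^sub>R b" "\<And>x. x = (\<Sum>b\<in>E. (b \<bullet> x) *\<^sub>R b)"
    by (rule selfadjoint_eigenbasis_UNIV) (use that in blast)
  have "?f b = 0" if b: "b \<in> E" for b
  proof -
    have "b \<bullet> b = 1" using E(2) b by simp
    then have "b \<noteq> 0" by auto
    then have pos: "0 < b \<bullet> (B *v b)" "0 < b \<bullet> (C *v b)"
      using B C by (auto simp: pos_def_mat_def)
    have "B *v (B *v b) = C *v (C *v b)"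
      by (simp add: matrix_vector_mul_assoc eq)
    then have "B *v ?f b + ?f (C *v b) = 0"
      by (simp add: f matrix_vector_mult_diff_distrib)
    then have "0 = b \<bullet> (B *v ?f b) + b \<bullet> ?f (C *v b)"
      by (metis inner_add_right inner_zero_right)
    also have "b \<bullet> ?f (C *v b) = ?f b \<bullet> (C *v b)"
      by (rule f_sym)
    finally have "l b * (b \<bullet> (B *v b) + b \<bullet> (C *v b)) = 0"
      by (simp add: E(3)[OF b] matrix_vector_mult_scaleR distrib_left)
    with pos have "l b = 0"
      by simp
    then show ?thesis
      by (simp add: E(3)[OF b])
  qed
  then have "?f x = 0" for x
    by (subst E(4)[of x]) (simp add: linear_sum[OF matrix_vector_mul_linear] matrix_vector_mult_scaleR)
  then show ?thesis
    by (simp add: matrix_eq f)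
qed

lemma mat_root_is_root:
  assumes "pos_def_mat A"
  shows "pos_def_mat (mat_root A)" and "mat_root A ** mat_root A = A"
proof -
  have "\<exists>!B. pos_def_mat B \<and> B ** B = A"
    using pos_def_mat_root_exists[OF assms] pos_def_mat_root_unique by blast
  from theI'[OF this] show "pos_def_mat (mat_root A)" "mat_root A ** mat_root A = A"
    unfolding mat_root_def by blast+
qed

lemma norm_mat_root_mult:
  assumes "pos_def_mat A"
  shows "(norm (mat_root A *v x))\<^sup>2 = x \<bullet> (A *v x)"
  by (simp add: power2_norm_eq_inner flip: pos_def_mat_selfadjoint[OF mat_root_is_root(1)[OF assms]])
     (simp add: matrix_vector_mul_assoc mat_root_is_root(2)[OF assms])

lemma pos_def_mat_inverse:
  fixes A :: "real^'n^'n"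
  assumes "pos_def_mat A"
  shows "A *v (matrix_inv A *v x) = x" and "matrix_inv A *v (A *v x) = x"
proof -
  have "\<forall>x. A *v x = 0 \<longrightarrow> x = 0"
    using assms unfolding pos_def_mat_def by (metis inner_zero_right less_irrefl)
  then have "invertible A"
    by (metis matrix_left_invertible_ker invertible_left_inverse)
  then have "A ** matrix_inv A = mat 1 \<and> matrix_inv A ** A = mat 1"
    unfolding invertible_def matrix_inv_def by (rule someI_ex)
  then show "A *v (matrix_inv A *v x) = x" and "matrix_inv A *v (A *v x) = x"
    by (simp_all add: matrix_vector_mul_assoc)
qed

text \<open>The left-hand side is the quadratic bound on the log-likelihood increment; on the right, the
  dependence on \<open>h\<close> is confined to one square.\<close>

lemma pos_def_mat_complete_square:
  fixes D :: "real^'n^'n"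
  assumes "pos_def_mat D"
  shows "h \<bullet> G - (norm (D *v h))\<^sup>2 / 2
    = (norm (matrix_inv D *v G))\<^sup>2 / 2 - (norm (D *v h - matrix_inv D *v G))\<^sup>2 / 2"
proof -
  have "h \<bullet> G = h \<bullet> (D *v (matrix_inv D *v G))"
    by (simp add: pos_def_mat_inverse[OF assms])
  also have "\<dots> = (D *v h) \<bullet> (matrix_inv D *v G)"
    by (rule pos_def_mat_selfadjoint[OF assms])
  finally show ?thesis
    by (simp add: power2_norm_eq_inner inner_simps inner_commute field_simps)
qed

lemma pos_def_mat_lincomb:
  fixes A B :: "real^'n^'n"
  assumes A: "pos_def_mat A" and B: "pos_def_mat B" and "0 < a" "0 \<le> b"
  shows "pos_def_mat (a *\<^sub>R A + b *\<^sub>R B)"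
proof -
  have ev: "(a *\<^sub>R A + b *\<^sub>R B) *v x = a *\<^sub>R (A *v x) + b *\<^sub>R (B *v x)" for x
    by (simp add: matrix_vector_mult_add_rdistrib scaleR_matrix_vector_assoc)
  have "0 < a * (x \<bullet> (A *v x)) + b * (x \<bullet> (B *v x))" if "x \<noteq> 0" for x
    using assms that unfolding pos_def_mat_def
    by (intro add_pos_nonneg mult_pos_pos mult_nonneg_nonneg) (auto intro: less_imp_le)
  then show ?thesis
    by (simp add: pos_def_mat_def transpose_eq_iff_selfadjoint ev inner_simps
        pos_def_mat_selfadjoint[OF A] pos_def_mat_selfadjoint[OF B])
qed

section \<open>Local set and gradients\<close>

text \<open>Compactness makes the suprema in \<open>diamond_upper\<close> and \<open>diamond_lower\<close> finite.\<close>

lemma compact_local_set: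
  assumes "pos_def_mat V"
  shows "compact (local_set V \<theta>s r)"
proof -
  have "local_set V \<theta>s r = (\<lambda>x. \<theta>s + matrix_inv V *v x) ` cball 0 r"
  proof (intro equalityI subsetI)
    fix \<theta> assume "\<theta> \<in> local_set V \<theta>s r"
    then show "\<theta> \<in> (\<lambda>x. \<theta>s + matrix_inv V *v x) ` cball 0 r"
      by (intro image_eqI[of _ _ "V *v (\<theta> - \<theta>s)"])
         (auto simp: local_set_def pos_def_mat_inverse[OF assms])
  qed (auto simp: local_set_def pos_def_mat_inverse[OF assms])
  also have "compact \<dots>"
    by (intro compact_continuous_image continuous_intros compact_cball)
  finally show ?thesis .
qed

lemma local_set_center_interior:
  assumes "0 < r" "local_set V \<theta>s r \<subseteq> S"
  shows "\<theta>s \<in> interior S"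
proof (rule interiorI)
  show "open {\<theta>. norm (V *v (\<theta> - \<theta>s)) < r}"
    by (intro open_Collect_less continuous_intros linear_continuous_on_compose[OF _ matrix_vector_mul_linear])
qed (use assms in \<open>auto simp: local_set_def\<close>)

lemma grad_within_eqI:
  fixes f :: "'a::euclidean_space \<Rightarrow> real"
  assumes "(f has_derivative (\<lambda>h. d \<bullet> h)) (at x)" "x \<in> interior S"
  shows "grad_within S f x = d"
  unfolding grad_within_def at_within_interior[OF assms(2)]
proof (rule some_equality)
  show "(f has_derivative (\<lambda>h. d \<bullet> h)) (at x)" by fact
  fix d' assume "(f has_derivative (\<lambda>h. d' \<bullet> h)) (at x)"
  then have "(\<lambda>h. d' \<bullet> h) = (\<lambda>h. d \<bullet> h)"
    using assms(1) has_derivative_unique by blast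
  then show "d' = d"
    by (metis vector_eq_rdot)
qed

text \<open>The representing vector of a linear functional \<open>f'\<close> is \<open>adjoint f' 1\<close>.\<close>

lemma grad_within_interior:
  fixes f :: "'a::euclidean_space \<Rightarrow> real"
  assumes "f differentiable_on S" "x \<in> interior S"
  shows "(f has_derivative (\<lambda>h. grad_within S f x \<bullet> h)) (at x)"
proof -
  have "f differentiable (at x)"
    using assms interior_subset at_within_interior[OF assms(2)]
    unfolding differentiable_on_def by (metis subsetD)
  then obtain f' where f': "(f has_derivative f') (at x)"
    unfolding differentiable_def by blast
  then have "linear f'"
    by (rule has_derivative_linear)
  then have "f' = (\<lambda>h. adjoint f' 1 \<bullet> h)"
    using adjoint_works[of f' _ 1] by (auto simp: inner_commute)
  with f' have *: "(f has_derivative (\<lambda>h. adjoint f' 1 \<bullet> h)) (at x)"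
    by simp
  then show ?thesis
    using grad_within_eqI[OF * assms(2)] by simp
qed

section \<open>The quadratic bracket\<close>

text \<open>A real-valued supremum bounds its members only if they are bounded above; here continuity on
  the compact local set guarantees it.\<close>

lemma zeta_remainder_le_diamond:
  assumes cont: "continuous_on (local_set V \<theta>s r) (zeta M L y)"
    and V: "pos_def_mat V" and \<theta>: "\<theta> \<in> local_set V \<theta>s r"
  shows "zeta M L y \<theta> - zeta M L y \<theta>s
      \<le> (\<theta> - \<theta>s) \<bullet> grad_within \<Theta> (zeta M L y) \<theta>s
        + \<rho> / 2 * (norm (V *v (\<theta> - \<theta>s)))\<^sup>2 + diamond_upper M L \<Theta> V \<theta>s \<rho> r y"
    and "zeta M L y \<theta> - zeta M L y \<theta>s
      \<ge> (\<theta> - \<theta>s) \<bullet> grad_within \<Theta> (zeta M L y) \<theta>s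
        - \<rho> / 2 * (norm (V *v (\<theta> - \<theta>s)))\<^sup>2 - diamond_lower M L \<Theta> V \<theta>s \<rho> r y"
proof -
  have bdd: "bdd_above (F ` local_set V \<theta>s r)" if "continuous_on (local_set V \<theta>s r) F"
    for F :: "_ \<Rightarrow> real"
    using compact_continuous_image[OF that compact_local_set[OF V]]
    by (intro bounded_imp_bdd_above compact_imp_bounded)
  have V_cont: "continuous_on (local_set V \<theta>s r) (\<lambda>\<theta>. V *v (\<theta> - \<theta>s))"
    by (intro continuous_intros linear_continuous_on_compose[OF _ matrix_vector_mul_linear])
  show "zeta M L y \<theta> - zeta M L y \<theta>s
      \<le> (\<theta> - \<theta>s) \<bullet> grad_within \<Theta> (zeta M L y) \<theta>s
        + \<rho> / 2 * (norm (V *v (\<theta> - \<theta>s)))\<^sup>2 + diamond_upper M L \<Theta> V \<theta>s \<rho> r y"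
    using cSUP_upper[OF \<theta> bdd, of "\<lambda>\<theta>. zeta M L y \<theta> - zeta M L y \<theta>s
        - (\<theta> - \<theta>s) \<bullet> grad_within \<Theta> (zeta M L y) \<theta>s - \<rho> / 2 * (norm (V *v (\<theta> - \<theta>s)))\<^sup>2"]
    unfolding diamond_upper_def by (force intro!: continuous_intros cont V_cont)
  show "zeta M L y \<theta> - zeta M L y \<theta>s
      \<ge> (\<theta> - \<theta>s) \<bullet> grad_within \<Theta> (zeta M L y) \<theta>s
        - \<rho> / 2 * (norm (V *v (\<theta> - \<theta>s)))\<^sup>2 - diamond_lower M L \<Theta> V \<theta>s \<rho> r y"
    using cSUP_upper[OF \<theta> bdd, of "\<lambda>\<theta>. - (zeta M L y \<theta> - zeta M L y \<theta>s)
        + (\<theta> - \<theta>s) \<bullet> grad_within \<Theta> (zeta M L y) \<theta>s - \<rho> / 2 * (norm (V *v (\<theta> - \<theta>s)))\<^sup>2"]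
    unfolding diamond_lower_def by (force intro!: continuous_intros cont V_cont)
qed

text \<open>\<open>L\<close> and \<open>zeta\<close> differ by the mean, whose gradient at \<open>\<theta>s\<close> is zero.\<close>

lemma grad_quasi_likelihood_at_target:
  fixes L :: "'y \<Rightarrow> real^'p \<Rightarrow> real"
  assumes "zeta M L y differentiable_on S" "\<theta>s \<in> interior S" "GDERIV (EL M L) \<theta>s :> 0"
  shows "grad_within S (L y) \<theta>s = grad_within S (zeta M L y) \<theta>s"
proof (rule grad_within_eqI[OF _ assms(2)])
  have "((\<lambda>\<theta>. zeta M L y \<theta> + EL M L \<theta>) has_derivative
      (\<lambda>h. grad_within S (zeta M L y) \<theta>s \<bullet> h + h \<bullet> 0)) (at \<theta>s)"
    by (intro has_derivative_add grad_within_interior assms(1,2) assms(3)[unfolded gderiv_def])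
  then show "(L y has_derivative (\<lambda>h. grad_within S (zeta M L y) \<theta>s \<bullet> h)) (at \<theta>s)"
    by (simp add: zeta_def)
qed

theorem corollary3p4:
  fixes M :: "'y measure"
    and \<Theta> :: "(real^'p) set"
    and L :: "'y \<Rightarrow> real^'p \<Rightarrow> real"
    and \<theta>t :: "'y \<Rightarrow> real^'p"
    and \<theta>s :: "real^'p"
    and V0_sq V0 D0_sq D0 D_up D_low :: "real^'p^'p"
    and g \<nu>0 r0 r \<omega>r \<delta>r \<delta> \<rho> :: real
    and e :: "real \<times> real"
  assumes prob: "prob_space M"
    and L_int: "\<And>\<theta>. \<theta> \<in> \<Theta> \<Longrightarrow> integrable M (\<lambda>y. L y \<theta>)"
    and mle: "\<And>y. y \<in> space M \<Longrightarrow> is_arg_max (L y) (\<lambda>\<theta>. \<theta> \<in> \<Theta>) (\<theta>t y)"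
    and target: "is_arg_max (EL M L) (\<lambda>\<theta>. \<theta> \<in> \<Theta>) \<theta>s"
    and grad_target: "GDERIV (EL M L) \<theta>s :> 0"
    and zeta_diff: "\<And>y. y \<in> space M \<Longrightarrow> zeta M L y differentiable_on \<Theta>"
    and V0_sq: "pos_def_mat V0_sq"
    and V0_def: "V0 = mat_root V0_sq"
    and pos: "0 < g" "1 \<le> \<nu>0" "0 < r0"
    and local_sub: "local_set V0 \<theta>s r0 \<subseteq> \<Theta>"
    and r_le: "r \<le> r0"
    and \<omega>r: "0 \<le> \<omega>r" "\<omega>r \<le> 1/2"
    and cond_i: "exp_moment_cond M L \<Theta> V0 \<theta>s g \<nu>0 r \<omega>r"
    and D0_sq: "pos_def_mat D0_sq"
    and D0_def: "D0 = mat_root D0_sq"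
    and \<delta>r: "0 \<le> \<delta>r" "\<delta>r \<le> 1/2"
    and cond_ii: "\<And>\<theta>. \<theta> \<in> local_set V0 \<theta>s r \<Longrightarrow> \<theta> \<noteq> \<theta>s \<Longrightarrow>
        \<bar>(- 2 * (\<integral>y. (L y \<theta> - L y \<theta>s) \<partial>M)) / (norm (D0 *v (\<theta> - \<theta>s)))\<^sup>2 - 1\<bar> \<le> \<delta>r"
    and \<rho>: "3 * \<nu>0 * \<omega>r \<le> \<rho>"
    and \<delta>: "\<delta>r \<le> \<delta>"
    and e_def: "e = (\<delta>, \<rho>)"
    and D_sq_pos: "pos_def_mat (D_sq D0_sq V0_sq e)"
    and D_up_def: "D_up = mat_root (D_sq D0_sq V0_sq e)"
    and D_low_def: "D_low = mat_root (D_sq D0_sq V0_sq (- e))"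
  shows "\<forall>y \<in> {y \<in> space M. \<theta>t y \<in> local_set V0 \<theta>s r \<and>
                 norm (V0 *v (matrix_inv D_low *v xi L \<Theta> \<theta>s D_low y)) \<le> r}.
           (norm (D_up *v (\<theta>t y - \<theta>s) - xi L \<Theta> \<theta>s D_up y))\<^sup>2
             \<le> 2 * spread M L \<Theta> V0_sq D0_sq \<theta>s e r y"
proof (intro ballI, elim CollectE conjE)
  fix y
  assume y: "y \<in> space M" and \<theta>t_loc: "\<theta>t y \<in> local_set V0 \<theta>s r"
    and low_loc: "norm (V0 *v (matrix_inv D_low *v xi L \<Theta> \<theta>s D_low y)) \<le> r"
  define G where "G = grad_within \<Theta> (zeta M L y) \<theta>s"
  define S_up where "S_up = diamond_upper M L \<Theta> V0 \<theta>s \<rho> r y"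
  define S_low where "S_low = diamond_lower M L \<Theta> V0 \<theta>s \<rho> r y"
  have \<delta>\<rho>: "0 \<le> \<delta>" "0 \<le> \<rho>"
    using \<delta> \<delta>r(1) \<rho> \<omega>r(1) pos(2) order_trans[OF mult_nonneg_nonneg \<rho>] by auto
  have D_low_sq: "D_sq D0_sq V0_sq (- e) = (1 + \<delta>) *\<^sub>R D0_sq + \<rho> *\<^sub>R V0_sq"
    by (simp add: D_sq_def e_def)
  have D_low_pos: "pos_def_mat (D_sq D0_sq V0_sq (- e))"
    unfolding D_low_sq using \<delta>\<rho> by (intro pos_def_mat_lincomb D0_sq V0_sq) auto
  have roots: "pos_def_mat V0" "pos_def_mat D_up" "pos_def_mat D_low"
    unfolding V0_def D_up_def D_low_def
    by (intro mat_root_is_root(1) V0_sq D_sq_pos D_low_pos)+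
  have V0_norm: "(norm (V0 *v h))\<^sup>2 = h \<bullet> (V0_sq *v h)"
    and D0_norm: "(norm (D0 *v h))\<^sup>2 = h \<bullet> (D0_sq *v h)" for h
    by (simp_all add: V0_def D0_def norm_mat_root_mult V0_sq D0_sq)
  have D_up_norm: "(norm (D_up *v h))\<^sup>2 = (1 - \<delta>) * (norm (D0 *v h))\<^sup>2 - \<rho> * (norm (V0 *v h))\<^sup>2" for h
    unfolding D_up_def norm_mat_root_mult[OF D_sq_pos] D0_norm V0_norm
    by (simp add: D_sq_def e_def matrix_vector_mult_diff_rdistrib inner_simps
        flip: scaleR_matrix_vector_assoc)
  have D_low_norm: "(norm (D_low *v h))\<^sup>2 = (1 + \<delta>) * (norm (D0 *v h))\<^sup>2 + \<rho> * (norm (V0 *v h))\<^sup>2" for h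
    unfolding D_low_def norm_mat_root_mult[OF D_low_pos] D0_norm V0_norm
    by (simp add: D_low_sq matrix_vector_mult_add_rdistrib inner_simps
        flip: scaleR_matrix_vector_assoc)
  have loc_sub: "local_set V0 \<theta>s r \<subseteq> \<Theta>"
    using local_sub r_le by (force simp: local_set_def)
  have \<theta>s_int: "\<theta>s \<in> interior \<Theta>"
    using local_set_center_interior[OF pos(3) local_sub] .
  then have \<theta>s: "\<theta>s \<in> \<Theta>"
    using interior_subset by blast
  have grad_L: "grad_within \<Theta> (L y) \<theta>s = G"
    unfolding G_def using grad_quasi_likelihood_at_target[OF zeta_diff[OF y] \<theta>s_int grad_target] .
  have zeta_cont: "continuous_on (local_set V0 \<theta>s r) (zeta M L y)"
    using continuous_on_subset[OF differentiable_imp_continuous_on[OF zeta_diff[OF y]] loc_sub] .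

  \<comment> \<open>Cleared of the quotient, the bound on the mean also holds at \<open>\<theta>s\<close>.\<close>
  have EL_bracket: "\<bar>- 2 * (EL M L \<theta> - EL M L \<theta>s) - (norm (D0 *v (\<theta> - \<theta>s)))\<^sup>2\<bar>
      \<le> \<delta> * (norm (D0 *v (\<theta> - \<theta>s)))\<^sup>2" if "\<theta> \<in> local_set V0 \<theta>s r" for \<theta>
  proof (cases "\<theta> = \<theta>s")
    case False
    let ?q = "(norm (D0 *v (\<theta> - \<theta>s)))\<^sup>2" and ?m = "- 2 * (EL M L \<theta> - EL M L \<theta>s)"
    have q: "?q > 0"
      using D0_sq False unfolding D0_norm pos_def_mat_def by simp
    have "(\<integral>y. (L y \<theta> - L y \<theta>s) \<partial>M) = EL M L \<theta> - EL M L \<theta>s"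
      unfolding EL_def using L_int \<theta>s that loc_sub by (intro Bochner_Integration.integral_diff) auto
    with cond_ii[OF that False] \<delta> have "\<bar>?m / ?q - 1\<bar> \<le> \<delta>"
      by simp
    then have "\<bar>?m / ?q - 1\<bar> * ?q \<le> \<delta> * ?q"
      using q by (intro mult_right_mono) auto
    moreover have "\<bar>?m / ?q - 1\<bar> * ?q = \<bar>(?m / ?q - 1) * ?q\<bar>"
      by (simp add: abs_mult)
    moreover have "(?m / ?q - 1) * ?q = ?m - ?q"
      using q by (metis left_diff_distrib less_irrefl mult_1 nonzero_eq_divide_eq)
    ultimately show ?thesis
      by simp
  qed simp
  have L_upper: "L y \<theta> - L y \<theta>s \<le> (\<theta> - \<theta>s) \<bullet> G - (norm (D_up *v (\<theta> - \<theta>s)))\<^sup>2 / 2 + S_up"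
    if "\<theta> \<in> local_set V0 \<theta>s r" for \<theta>
    using EL_bracket[OF that] zeta_remainder_le_diamond(1)[OF zeta_cont roots(1) that, of \<Theta> \<rho>]
    by (simp add: D_up_norm zeta_def[of M L y \<theta>] zeta_def[of M L y \<theta>s] G_def S_up_def abs_le_iff field_simps)
  have L_lower: "L y \<theta> - L y \<theta>s \<ge> (\<theta> - \<theta>s) \<bullet> G - (norm (D_low *v (\<theta> - \<theta>s)))\<^sup>2 / 2 - S_low"
    if "\<theta> \<in> local_set V0 \<theta>s r" for \<theta>
    using EL_bracket[OF that] zeta_remainder_le_diamond(2)[OF zeta_cont roots(1) that, of \<Theta> \<rho>]
    by (simp add: D_low_norm zeta_def[of M L y \<theta>] zeta_def[of M L y \<theta>s] G_def S_low_def abs_le_iff field_simps)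

  define \<xi>_up where "\<xi>_up = xi L \<Theta> \<theta>s D_up y"
  define \<xi>_low where "\<xi>_low = xi L \<Theta> \<theta>s D_low y"
  have \<xi>: "\<xi>_up = matrix_inv D_up *v G" "\<xi>_low = matrix_inv D_low *v G"
    by (simp_all add: \<xi>_up_def \<xi>_low_def xi_def grad_L)
  have above: "L y (\<theta>t y) - L y \<theta>s
      \<le> (norm \<xi>_up)\<^sup>2 / 2 - (norm (D_up *v (\<theta>t y - \<theta>s) - \<xi>_up))\<^sup>2 / 2 + S_up"
    using L_upper[OF \<theta>t_loc] pos_def_mat_complete_square[OF roots(2), of "\<theta>t y - \<theta>s" G]
    by (simp add: \<xi>)

  \<comment> \<open>The vertex of the lower quadratic bound.\<close>
  define \<theta>l where "\<theta>l = \<theta>s + matrix_inv D_low *v \<xi>_low"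
  have \<theta>l_loc: "\<theta>l \<in> local_set V0 \<theta>s r"
    using low_loc by (simp add: \<theta>l_def local_set_def \<xi>_low_def)
  have "D_low *v (\<theta>l - \<theta>s) = \<xi>_low"
    by (simp add: \<theta>l_def pos_def_mat_inverse[OF roots(3)])
  then have "(norm \<xi>_low)\<^sup>2 / 2 - S_low \<le> L y \<theta>l - L y \<theta>s"
    using L_lower[OF \<theta>l_loc] pos_def_mat_complete_square[OF roots(3), of "\<theta>l - \<theta>s" G]
    by (simp add: \<xi>)
  also have "L y \<theta>l \<le> L y (\<theta>t y)"
    using mle[OF y] \<theta>l_loc loc_sub unfolding is_arg_max_linorder by blast
  then have "L y \<theta>l - L y \<theta>s \<le> L y (\<theta>t y) - L y \<theta>s"
    by simp
  finally have "(norm (D_up *v (\<theta>t y - \<theta>s) - \<xi>_up))\<^sup>2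
      \<le> 2 * (S_up + S_low + ((norm \<xi>_up)\<^sup>2 - (norm \<xi>_low)\<^sup>2) / 2)"
    using above by (simp add: field_simps)
  then show "(norm (D_up *v (\<theta>t y - \<theta>s) - xi L \<Theta> \<theta>s D_up y))\<^sup>2
      \<le> 2 * spread M L \<Theta> V0_sq D0_sq \<theta>s e r y"
    by (simp only: spread_def S_up_def S_low_def \<xi>_up_def \<xi>_low_def V0_def D_up_def D_low_def
        e_def snd_conv)
qed

end
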